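(* Assume that $\Omega$ is a bounded polyhedral set and that each $\rho_i=(L^+)^*a_i$, $1\le i\le m$, is a piecewise linear function with finitely many regions, all polyhedral. Let $(v_j)_{j\in J}$ be the finite family of vertices of the polyhedral pieces. Suppose that $\operatorname{ran}L=\mathcal M$ and that the dual problem $$\sup\left\{-f_b^*(q)\ :\ q\in\mathbb R^m,\ A^*q\in\operatorname{ran}L^*,\ \|(L^+)^*A^*q\|_\infty\le1\right\}$$ has a solution. Then the problem $$\min_{u\in\mathcal B} f_b(Au)+\|Lu\|_{TV}$$ has at least one solution of the form $$\hat u=u_K+\sum_{j\in J}d_j\,L^+\delta_{v_j}$$ with $u_K\in\ker L$ and $d_j\in\mathbb R$.
   Context: Let $\Omega\subseteq\mathbb R^d$ be open, $\mathcal D'(\Omega)$ the space of distributions on $\Omega$, $C_0(\Omega)$ the space of continuous real functions on $\Omega$ vanishing at infinity (for every $\epsilon>0$ there is a compact $C\subset\Omega$ with $|f|<\epsilon$ off $C$), and $\mathcal M=\mathcal M(\Omega)=C_0(\Omega)^*$ the Banach space of Radon measures with the total variation norm $\|\cdot\|_{TV}$. Let $L:\mathcal D'(\Omega)\to\mathcal D'(\Omega)$ be a continuous linear operator and $\mathcal B^\circ=\{u\in\mathcal D'(\Omega): Lu\in\mathcal M(\Omega)\}$. Let $\|\cdot\|_K$ be a (possibly $+\infty$-valued) semi-norm on $\mathcal B^\circ$ whose restriction to $\ker L$ is a norm. Set $\mathcal B=\{u\in\mathcal D'(\Omega): Lu\in\mathcal M(\Omega),\ \|u\|_K<\infty\}$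 with norm $\|u\|=\|Lu\|_{TV}+\|u\|_K$; from now on $L$ is regarded as an operator $\mathcal B\to\mathcal M$. Standing assumptions: (i) $\mathcal B$ is a Banach space. (ii) There is a closed subspace $V$ of $\mathcal B$ with $\ker L\oplus V=\mathcal B$; $\operatorname{ran}L$ is closed and has a complementary (closed) subspace $W$, $\operatorname{ran}L\oplus W=\mathcal M$. The pseudoinverse is $L^+=j_V(L|_V)^{-1}\Pi_{\operatorname{ran}L}:\mathcal M\to\mathcal B$, with $j_V:V\hookrightarrow\mathcal B$ the injection and $\Pi_{\operatorname{ran}L}$ the projection onto $\operatorname{ran}L$ along $W$. (iii) $a_1,\dots,a_m\in\mathcal B^*$ are such that $(L^+)^*a_i\in C_0(\Omega)$, i.e. there is $\rho_i\in C_0(\Omega)$ with $\langle(L^+)^*a_i,\mu\rangle=\int_\Omega\rho_i\,d\mu$ for all $\mu\in\mathcal M$. (iv) The problem $\min_{u\in\mathcal B}f_b(Au)+\|Lu\|_{TV}$ has at least one solution. (v) $f_b:\mathbb R^m\to\mathbb R\cup\{+\infty\}$ is convex and lower semicontinuous. The measurement operator is $A:\mathcal B\to\mathbb R^m$, $(Au)_i=\langle a_i,u\rangle$; $A^*:\mathbb R^m\to\mathcal B^*$, $L^*:\mathcal M^*\to\mathcal B^*$, $(L^+)^*:\mathcal B^*\to\mathcal M^*$ are adjoints; $f_b^*$ is the Fenchel conjugate. One has $(L^+)^*A^*q=\sum_i q_i\rho_i$. Piecewise linearity means: $\overline\Omega$ is a finite union of (convex, compact) polytopes with disjoint interiors,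 on each of which every $\rho_i$ (continuously extended by $0$ to $\partial\Omega$) is affine; the polyhedral pieces are these polytopes (common to all $\rho_i$). Since $\Omega$ is open, a vertex lying on $\partial\Omega$ is understood to contribute nothing, i.e. $\delta_v:=0$ in $\mathcal M(\Omega)$ if $v\in\partial\Omega$. *)

theory Defs
  imports "HOL-Analysis.Analysis" "HOL-Library.Function_Algebras"
begin

text \<open>
  Function spaces on an open set \<open>\<Omega>\<close>, and their duals, are subspaces of full function
  types. Every element vanishes outside its domain (\<open>\<Omega>\<close>, respectively the space on which
  a functional acts), so that equality of elements is equality of HOL functions.
\<close>

instantiation "fun" :: (type, real_vector) real_vector
begin

definition scaleR_fun :: "real \<Rightarrow> ('a \<Rightarrow> 'b) \<Rightarrow> 'a \<Rightarrow> 'b"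
  where "scaleR_fun c f = (\<lambda>x. c *\<^sub>R f x)"

instance
  by standard (auto simp: scaleR_fun_def fun_eq_iff algebra_simps)

end

subsection \<open>Normed spaces given by a carrier\<close>

definition linear_on :: "'a::real_vector set \<Rightarrow> ('a \<Rightarrow> 'b::real_vector) \<Rightarrow> bool"
  where "linear_on X T \<longleftrightarrow>
    (\<forall>x\<in>X. \<forall>y\<in>X. T (x + y) = T x + T y) \<and> (\<forall>c. \<forall>x\<in>X. T (c *\<^sub>R x) = c *\<^sub>R T x)"

definition norm_on :: "'a::real_vector set \<Rightarrow> ('a \<Rightarrow> real) \<Rightarrow> bool"
  where "norm_on X N \<longleftrightarrow>
    (\<forall>x\<in>X. 0 \<le> N x \<and> (N x = 0 \<longleftrightarrow> x = 0)) \<and>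
    (\<forall>x\<in>X. \<forall>y\<in>X. N (x + y) \<le> N x + N y) \<and>
    (\<forall>c. \<forall>x\<in>X. N (c *\<^sub>R x) = \<bar>c\<bar> * N x)"

definition banach_on :: "'a::real_vector set \<Rightarrow> ('a \<Rightarrow> real) \<Rightarrow> bool"
  where "banach_on X N \<longleftrightarrow>
    subspace X \<and> norm_on X N \<and> Metric_space.mcomplete X (\<lambda>x y. N (x - y))"

definition closed_subspace_of :: "'a::real_vector set \<Rightarrow> 'a set \<Rightarrow> ('a \<Rightarrow> real) \<Rightarrow> bool"
  where "closed_subspace_of S X N \<longleftrightarrow>
    subspace S \<and> closedin (Metric_space.mtopology X (\<lambda>x y. N (x - y))) S"

definition direct_sum :: "'a::real_vector set \<Rightarrow> 'a set \<Rightarrow> 'a set \<Rightarrow> bool"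
  where "direct_sum S T X \<longleftrightarrow> S \<inter> T = {0} \<and> {s + t |s t. s \<in> S \<and> t \<in> T} = X"

definition proj_along :: "'a::real_vector set \<Rightarrow> 'a set \<Rightarrow> 'a \<Rightarrow> 'a"
  where "proj_along S T x = (THE s. s \<in> S \<and> x - s \<in> T)"

definition dual_space :: "'a::real_vector set \<Rightarrow> ('a \<Rightarrow> real) \<Rightarrow> ('a \<Rightarrow> real) set"
  where "dual_space X N =
    {f. linear_on X f \<and> (\<exists>C. \<forall>x\<in>X. \<bar>f x\<bar> \<le> C * N x) \<and> (\<forall>x. x \<notin> X \<longrightarrow> f x = 0)}"

definition dual_norm :: "'a::real_vector set \<Rightarrow> ('a \<Rightarrow> real) \<Rightarrow> ('a \<Rightarrow> real) \<Rightarrow> real"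
  where "dual_norm X N f = (SUP x\<in>{x \<in> X. N x \<le> 1}. \<bar>f x\<bar>)"

text \<open>The adjoint of an operator \<open>T\<close> with domain \<open>X\<close>, acting on functionals.\<close>

definition adjoint_on :: "'a set \<Rightarrow> ('a \<Rightarrow> 'b) \<Rightarrow> ('b \<Rightarrow> real) \<Rightarrow> 'a \<Rightarrow> real"
  where "adjoint_on X T f = (\<lambda>x. if x \<in> X then f (T x) else 0)"

subsection \<open>Distributions\<close>

text \<open>The list \<open>\<alpha>\<close> records the coordinate directions of an iterated partial derivative.\<close>

primrec iter_partial :: "'d list \<Rightarrow> (real^'d \<Rightarrow> real) \<Rightarrow> real^'d \<Rightarrow> real"
  where
    "iter_partial [] f = f"
  | "iter_partial (i # \<alpha>) f = (\<lambda>x. frechet_derivative (iter_partial \<alpha> f) (at x) (axis i 1))"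

definition test_functions :: "(real^'d) set \<Rightarrow> (real^'d \<Rightarrow> real) set"
  where "test_functions \<Omega> =
    {\<phi>. (\<forall>\<alpha>. iter_partial \<alpha> \<phi> differentiable_on UNIV) \<and>
        compact (closure {x. \<phi> x \<noteq> 0}) \<and> closure {x. \<phi> x \<noteq> 0} \<subseteq> \<Omega>}"

definition distributions :: "(real^'d) set \<Rightarrow> ((real^'d \<Rightarrow> real) \<Rightarrow> real) set"
  where "distributions \<Omega> =
    {T. linear_on (test_functions \<Omega>) T \<and>
        (\<forall>C. compact C \<and> C \<subseteq> \<Omega> \<longrightarrow>
          (\<exists>c N. \<forall>\<phi>\<in>test_functions \<Omega>. closure {x. \<phi> x \<noteq> 0} \<subseteq> C \<longrightarrow>
            \<bar>T \<phi>\<bar> \<le> c * (\<Sum>\<alpha> | length \<alpha> \<le> N. SUP x. \<bar>iter_partial \<alpha> \<phi> x\<bar>))) \<and>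
        (\<forall>\<phi>. \<phi> \<notin> test_functions \<Omega> \<longrightarrow> T \<phi> = 0)}"

text \<open>
  The topology that HOL-Analysis puts on function types is that of pointwise convergence. On
  \<^const>\<open>distributions\<close> it is therefore the weak-* topology of the space of distributions.
  For linear operators between spaces of distributions, continuity for the weak-* topologies
  and for the strong dual topologies coincide.
\<close>

definition dist_operator ::
    "(real^'d) set \<Rightarrow> (((real^'d \<Rightarrow> real) \<Rightarrow> real) \<Rightarrow> (real^'d \<Rightarrow> real) \<Rightarrow> real) \<Rightarrow> bool"
  where "dist_operator \<Omega> L \<longleftrightarrow>
    L ` distributions \<Omega> \<subseteq> distributions \<Omega> \<and> linear_on (distributions \<Omega>) L \<and>
    continuous_on (distributions \<Omega>) L"

definition dist_kernel ::
    "(real^'d) set \<Rightarrow> (((real^'d \<Rightarrow> real) \<Rightarrow> real) \<Rightarrow> (real^'d \<Rightarrow> real) \<Rightarrow> real)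
      \<Rightarrow> ((real^'d \<Rightarrow> real) \<Rightarrow> real) set"
  where "dist_kernel \<Omega> L = {u \<in> distributions \<Omega>. L u = 0}"

subsection \<open>Radon measures\<close>

definition C0 :: "(real^'d) set \<Rightarrow> (real^'d \<Rightarrow> real) set"
  where "C0 \<Omega> =
    {f. continuous_on \<Omega> f \<and>
        (\<forall>\<epsilon>>0. \<exists>C. compact C \<and> C \<subseteq> \<Omega> \<and> (\<forall>x\<in>\<Omega> - C. \<bar>f x\<bar> < \<epsilon>)) \<and>
        (\<forall>x. x \<notin> \<Omega> \<longrightarrow> f x = 0)}"

definition sup_norm :: "(real^'d \<Rightarrow> real) \<Rightarrow> real"
  where "sup_norm f = (SUP x. \<bar>f x\<bar>)"

text \<open>
  Radon measures are the bounded functionals on \<open>C0 \<Omega>\<close>: the value of \<open>\<mu>\<close> at \<open>\<rho>\<close> is the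
  integral of \<open>\<rho>\<close> against \<open>\<mu>\<close>, and the total variation norm is the dual norm.
\<close>

definition radon :: "(real^'d) set \<Rightarrow> ((real^'d \<Rightarrow> real) \<Rightarrow> real) set"
  where "radon \<Omega> = dual_space (C0 \<Omega>) sup_norm"

definition tv_norm :: "(real^'d) set \<Rightarrow> ((real^'d \<Rightarrow> real) \<Rightarrow> real) \<Rightarrow> real"
  where "tv_norm \<Omega> = dual_norm (C0 \<Omega>) sup_norm"

definition delta :: "(real^'d) set \<Rightarrow> real^'d \<Rightarrow> (real^'d \<Rightarrow> real) \<Rightarrow> real"
  where "delta \<Omega> v = (\<lambda>f. if f \<in> C0 \<Omega> \<and> v \<in> \<Omega> then f v else 0)"

definition dist_of_radon ::
    "(real^'d) set \<Rightarrow> ((real^'d \<Rightarrow> real) \<Rightarrow> real) \<Rightarrow> (real^'d \<Rightarrow> real) \<Rightarrow> real"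
  where "dist_of_radon \<Omega> \<mu> = (\<lambda>\<phi>. if \<phi> \<in> test_functions \<Omega> then \<mu> \<phi> else 0)"

text \<open>
  The canonical embedding of \<open>C0 \<Omega>\<close> into the dual of \<open>radon \<Omega>\<close>, and its inverse, which is
  meaningful only on the range of the embedding.
\<close>

definition C0_embed ::
    "(real^'d) set \<Rightarrow> (real^'d \<Rightarrow> real) \<Rightarrow> ((real^'d \<Rightarrow> real) \<Rightarrow> real) \<Rightarrow> real"
  where "C0_embed \<Omega> \<rho> = (\<lambda>\<mu>. if \<mu> \<in> radon \<Omega> then \<mu> \<rho> else 0)"

definition C0_unembed ::
    "(real^'d) set \<Rightarrow> (((real^'d \<Rightarrow> real) \<Rightarrow> real) \<Rightarrow> real) \<Rightarrow> real^'d \<Rightarrow> real"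
  where "C0_unembed \<Omega> = the_inv_into (C0 \<Omega>) (C0_embed \<Omega>)"

subsection \<open>The space \<open>\<B>\<close>, the operator \<open>L : \<B> \<rightarrow> \<M>\<close> and its pseudoinverse\<close>

text \<open>
  \<open>pre_B\<close> is the set of distributions \<open>u\<close> such that \<open>L u\<close> is a Radon measure; \<open>op_BM\<close> sends
  such a \<open>u\<close> to that measure, whereas \<open>L u\<close> itself is a distribution.
\<close>

definition pre_B ::
    "(real^'d) set \<Rightarrow> (((real^'d \<Rightarrow> real) \<Rightarrow> real) \<Rightarrow> (real^'d \<Rightarrow> real) \<Rightarrow> real)
      \<Rightarrow> ((real^'d \<Rightarrow> real) \<Rightarrow> real) set"
  where "pre_B \<Omega> L = {u \<in> distributions \<Omega>. L u \<in> dist_of_radon \<Omega> ` radon \<Omega>}"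

definition op_BM ::
    "(real^'d) set \<Rightarrow> (((real^'d \<Rightarrow> real) \<Rightarrow> real) \<Rightarrow> (real^'d \<Rightarrow> real) \<Rightarrow> real)
      \<Rightarrow> ((real^'d \<Rightarrow> real) \<Rightarrow> real) \<Rightarrow> (real^'d \<Rightarrow> real) \<Rightarrow> real"
  where "op_BM \<Omega> L u = the_inv_into (radon \<Omega>) (dist_of_radon \<Omega>) (L u)"

definition ext_seminorm_on :: "'a::real_vector set \<Rightarrow> ('a \<Rightarrow> ennreal) \<Rightarrow> bool"
  where "ext_seminorm_on X k \<longleftrightarrow>
    (\<forall>u\<in>X. \<forall>w\<in>X. k (u + w) \<le> k u + k w) \<and> (\<forall>c. \<forall>u\<in>X. k (c *\<^sub>R u) = ennreal \<bar>c\<bar> * k u)"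

definition space_B ::
    "(real^'d) set \<Rightarrow> (((real^'d \<Rightarrow> real) \<Rightarrow> real) \<Rightarrow> (real^'d \<Rightarrow> real) \<Rightarrow> real)
      \<Rightarrow> (((real^'d \<Rightarrow> real) \<Rightarrow> real) \<Rightarrow> ennreal) \<Rightarrow> ((real^'d \<Rightarrow> real) \<Rightarrow> real) set"
  where "space_B \<Omega> L k = {u \<in> pre_B \<Omega> L. k u < \<infinity>}"

definition norm_B ::
    "(real^'d) set \<Rightarrow> (((real^'d \<Rightarrow> real) \<Rightarrow> real) \<Rightarrow> (real^'d \<Rightarrow> real) \<Rightarrow> real)
      \<Rightarrow> (((real^'d \<Rightarrow> real) \<Rightarrow> real) \<Rightarrow> ennreal) \<Rightarrow> ((real^'d \<Rightarrow> real) \<Rightarrow> real) \<Rightarrow> real"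
  where "norm_B \<Omega> L k u = tv_norm \<Omega> (op_BM \<Omega> L u) + enn2real (k u)"

definition ran_L ::
    "(real^'d) set \<Rightarrow> (((real^'d \<Rightarrow> real) \<Rightarrow> real) \<Rightarrow> (real^'d \<Rightarrow> real) \<Rightarrow> real)
      \<Rightarrow> (((real^'d \<Rightarrow> real) \<Rightarrow> real) \<Rightarrow> ennreal) \<Rightarrow> ((real^'d \<Rightarrow> real) \<Rightarrow> real) set"
  where "ran_L \<Omega> L k = op_BM \<Omega> L ` space_B \<Omega> L k"

definition pinv_L ::
    "(real^'d) set \<Rightarrow> (((real^'d \<Rightarrow> real) \<Rightarrow> real) \<Rightarrow> (real^'d \<Rightarrow> real) \<Rightarrow> real)
      \<Rightarrow> (((real^'d \<Rightarrow> real) \<Rightarrow> real) \<Rightarrow> ennreal)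
      \<Rightarrow> ((real^'d \<Rightarrow> real) \<Rightarrow> real) set \<Rightarrow> ((real^'d \<Rightarrow> real) \<Rightarrow> real) set
      \<Rightarrow> ((real^'d \<Rightarrow> real) \<Rightarrow> real) \<Rightarrow> (real^'d \<Rightarrow> real) \<Rightarrow> real"
  where "pinv_L \<Omega> L k V W \<mu> = the_inv_into V (op_BM \<Omega> L) (proj_along (ran_L \<Omega> L k) W \<mu>)"

subsection \<open>The optimization problems\<close>

definition lower_semicont :: "('a::topological_space \<Rightarrow> ereal) \<Rightarrow> bool"
  where "lower_semicont f \<longleftrightarrow> (\<forall>x. f x \<le> Liminf (at x) f)"

definition ext_convex :: "('a::real_vector \<Rightarrow> ereal) \<Rightarrow> bool"
  where "ext_convex f \<longleftrightarrow>
    (\<forall>x y t. 0 \<le> t \<and> t \<le> 1 \<longrightarrow>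
      f ((1 - t) *\<^sub>R x + t *\<^sub>R y) \<le> ereal (1 - t) * f x + ereal t * f y)"

definition fenchel_conj :: "('a::real_inner \<Rightarrow> ereal) \<Rightarrow> 'a \<Rightarrow> ereal"
  where "fenchel_conj f q = (SUP y. ereal (q \<bullet> y) - f y)"

definition measure_op :: "('m \<Rightarrow> 'u \<Rightarrow> real) \<Rightarrow> 'u \<Rightarrow> real^'m"
  where "measure_op a u = (\<chi> i. a i u)"

definition primal_objective ::
    "(real^'d) set \<Rightarrow> (((real^'d \<Rightarrow> real) \<Rightarrow> real) \<Rightarrow> (real^'d \<Rightarrow> real) \<Rightarrow> real)
      \<Rightarrow> (real^'m \<Rightarrow> ereal) \<Rightarrow> ('m \<Rightarrow> ((real^'d \<Rightarrow> real) \<Rightarrow> real) \<Rightarrow> real)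
      \<Rightarrow> ((real^'d \<Rightarrow> real) \<Rightarrow> real) \<Rightarrow> ereal"
  where "primal_objective \<Omega> L f a u = f (measure_op a u) + ereal (tv_norm \<Omega> (op_BM \<Omega> L u))"

text \<open>The dual of \<open>real^'m\<close> is identified with \<open>real^'m\<close> by the inner product.\<close>

definition adjoint_A ::
    "(real^'d) set \<Rightarrow> (((real^'d \<Rightarrow> real) \<Rightarrow> real) \<Rightarrow> (real^'d \<Rightarrow> real) \<Rightarrow> real)
      \<Rightarrow> (((real^'d \<Rightarrow> real) \<Rightarrow> real) \<Rightarrow> ennreal)
      \<Rightarrow> ('m::finite \<Rightarrow> ((real^'d \<Rightarrow> real) \<Rightarrow> real) \<Rightarrow> real)
      \<Rightarrow> real^'m \<Rightarrow> ((real^'d \<Rightarrow> real) \<Rightarrow> real) \<Rightarrow> real"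
  where "adjoint_A \<Omega> L k a q = adjoint_on (space_B \<Omega> L k) (measure_op a) (\<lambda>y. q \<bullet> y)"

definition dual_feasible ::
    "(real^'d) set \<Rightarrow> (((real^'d \<Rightarrow> real) \<Rightarrow> real) \<Rightarrow> (real^'d \<Rightarrow> real) \<Rightarrow> real)
      \<Rightarrow> (((real^'d \<Rightarrow> real) \<Rightarrow> real) \<Rightarrow> ennreal)
      \<Rightarrow> ((real^'d \<Rightarrow> real) \<Rightarrow> real) set \<Rightarrow> ((real^'d \<Rightarrow> real) \<Rightarrow> real) set
      \<Rightarrow> ('m::finite \<Rightarrow> ((real^'d \<Rightarrow> real) \<Rightarrow> real) \<Rightarrow> real) \<Rightarrow> real^'m \<Rightarrow> bool"
  where "dual_feasible \<Omega> L k V W a q \<longleftrightarrow>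
    adjoint_A \<Omega> L k a q
      \<in> adjoint_on (space_B \<Omega> L k) (op_BM \<Omega> L) ` dual_space (radon \<Omega>) (tv_norm \<Omega>) \<and>
    sup_norm (C0_unembed \<Omega>
      (adjoint_on (radon \<Omega>) (pinv_L \<Omega> L k V W) (adjoint_A \<Omega> L k a q))) \<le> 1"

subsection \<open>Polyhedral pieces\<close>

definition polyhedral_pieces :: "(real^'d) set \<Rightarrow> (real^'d) set set \<Rightarrow> bool"
  where "polyhedral_pieces \<Omega> \<P> \<longleftrightarrow>
    finite \<P> \<and> (\<forall>P\<in>\<P>. polytope P) \<and> closure \<Omega> = \<Union>\<P> \<and>
    pairwise (\<lambda>P Q. interior P \<inter> interior Q = {}) \<P>"

definition affine_on :: "(real^'d) set \<Rightarrow> (real^'d \<Rightarrow> real) \<Rightarrow> bool"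
  where "affine_on P f \<longleftrightarrow> (\<exists>c b. \<forall>x\<in>P. f x = c \<bullet> x + b)"

definition vertices :: "(real^'d) set set \<Rightarrow> (real^'d) set"
  where "vertices \<P> = {v. \<exists>P\<in>\<P>. v extreme_point_of P}"

end

theory Submission
  imports Defs
begin

text \<open>
  Let \<open>u\<close> be a minimizer and \<open>\<nu> = L u\<close>. The measurements of \<open>u\<close> split as
  \<open>a i u = a i (u - L\<^sup>+ \<nu>) + \<nu> (\<rho> i)\<close>, where \<open>u - L\<^sup>+ \<nu>\<close> lies in the kernel of \<open>L\<close>. So \<open>\<nu>\<close> may be
  replaced by any measure \<open>\<nu>'\<close> that has the same integrals against the finitely many \<open>\<rho> i\<close> and no
  larger total variation: \<open>u - L\<^sup>+ \<nu> + L\<^sup>+ \<nu>'\<close> has the same measurements as \<open>u\<close>, its image under \<open>L\<close>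
  is \<open>\<nu>'\<close>, and its objective is therefore no larger.

  A combination \<open>\<nu>'\<close> of Dirac measures at the vertices can be found (\<open>radon_discretization\<close>) because
  a function in the span of the \<open>\<rho> i\<close>, being affine on each polytope, attains its sup norm at a
  vertex (\<open>piecewise_affine_abs_le\<close>). The restriction of \<open>\<nu>\<close> to this span is thus a functional of norm
  at most \<open>\<parallel>\<nu>\<parallel>\<close> for the maximum over the vertices, and separation from a compact convex
  polytope represents it by point evaluations with coefficients of absolute sum at most \<open>\<parallel>\<nu>\<parallel>\<close>
  (\<open>l1_bounded_combination_if_functionals_bounded\<close>).

  The algebra of \<open>L\<close> and \<open>L\<^sup>+\<close> uses that \<open>L u\<close>, given as a distribution, determines the measure
  \<open>\<nu>\<close>. This is \<open>inj_on_dist_of_radon\<close>; it rests on the density of test functions in \<open>C0 \<Omega>\<close>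
  (\<open>test_functions_dense_C0\<close>).
\<close>

section \<open>Density of test functions\<close>

text \<open>
  The classical flat function is \<open>n = 0\<close>. The factors \<open>t\<^sup>-\<^sup>n\<close> make the family closed under
  differentiation up to linear combinations, so that smoothness needs only first derivatives.
\<close>

definition flat :: "nat \<Rightarrow> real \<Rightarrow> real"
  where "flat n t = (if 0 < t then (1 / t) ^ n * exp (- (1 / t)) else 0)"

lemma flat_tendsto_0: "(flat n \<longlongrightarrow> 0) (at 0)"
proof -
  have "((\<lambda>t::real. inverse t ^ n / exp (inverse t)) \<longlongrightarrow> 0) (at_right 0)"
    by (rule filterlim_compose[OF tendsto_power_div_exp_0 filterlim_inverse_at_top_right])
  moreover have "\<forall>\<^sub>F t in at_right 0. inverse t ^ n / exp (inverse t) = flat n t"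
    by (auto simp: eventually_at_filter flat_def exp_minus field_simps)
  ultimately have "(flat n \<longlongrightarrow> 0) (at_right 0)"
    using Lim_transform_eventually by blast
  moreover have "(flat n \<longlongrightarrow> 0) (at_left 0)"
  proof (rule Lim_transform_eventually[OF tendsto_const])
    show "\<forall>\<^sub>F t in at_left 0. 0 = flat n t"
      by (auto simp: eventually_at_filter flat_def)
  qed
  ultimately show ?thesis
    by (simp add: filterlim_split_at)
qed

text \<open>
  Only \<open>t = 0\<close> is not plain calculus: there the difference quotient of \<open>flat n\<close> is
  \<open>flat (n + 1)\<close>, which tends to \<open>0\<close>.
\<close>

lemma flat_has_real_derivative:
  "(flat n has_real_derivative flat (n + 2) t - real n * flat (n + 1) t) (at t)"
proof -
  consider "t < 0" | "t = 0" | "t > 0" by linarith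
  then show ?thesis
  proof cases
    case 1
    have "((\<lambda>t::real. 0) has_real_derivative flat (n + 2) t - real n * flat (n + 1) t) (at t)"
      using 1 by (simp add: flat_def)
    then show ?thesis
      by (rule has_field_derivative_transform_within_open[where S = "{..<0}"])
         (use 1 in \<open>auto simp: flat_def\<close>)
  next
    case 2
    have "(flat n h - flat n 0) / h = flat (n + 1) h" for h
      by (simp add: flat_def field_simps)
    then have "(\<lambda>h. (flat n (0 + h) - flat n 0) / h) \<midarrow>0\<rightarrow> 0"
      using flat_tendsto_0[of "n + 1"] by simp
    then show ?thesis
      using 2 by (simp add: DERIV_def flat_def)
  next
    case 3
    have inv: "((\<lambda>t. 1 / t) has_real_derivative - ((1 / t) * (1 / t))) (at t)"
      using 3 by (auto intro!: derivative_eq_intros)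
    have "((\<lambda>t. (1 / t) ^ n) has_real_derivative - (real n * (1 / t) ^ (n + 1))) (at t)"
      by (rule DERIV_cong[OF DERIV_power[OF inv]]) (cases n; simp)
    moreover have "((\<lambda>t. exp (- (1 / t))) has_real_derivative
        exp (- (1 / t)) * ((1 / t) * (1 / t))) (at t)"
      by (rule DERIV_cong[OF DERIV_chain2[OF DERIV_exp DERIV_minus[OF inv]]]) simp
    ultimately have "((\<lambda>t. (1 / t) ^ n * exp (- (1 / t))) has_real_derivative
        flat (n + 2) t - real n * flat (n + 1) t) (at t)"
      using 3 by (intro DERIV_cong[OF DERIV_mult]) (auto simp: flat_def algebra_simps)
    then show ?thesis
      by (rule has_field_derivative_transform_within_open[where S = "{0<..}"])
         (use 3 in \<open>auto simp: flat_def\<close>)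
  qed
qed

lemma real_polynomial_function_has_derivative:
  fixes p :: "'a::real_normed_vector \<Rightarrow> real"
  assumes "real_polynomial_function p"
  shows "\<exists>p'. (\<forall>x. (p has_derivative p' x) (at x)) \<and>
    (\<forall>v. real_polynomial_function (\<lambda>x. p' x v))"
  using assms
proof induction
  case (linear f)
  then show ?case
    by (intro exI[of _ "\<lambda>x. f"]) (auto intro: bounded_linear_imp_has_derivative
        real_polynomial_function.intros)
next
  case (const c)
  then show ?case
    by (intro exI[of _ "\<lambda>x v. 0"]) (auto intro: real_polynomial_function.intros)
next
  case (add f g)
  then obtain f' g' where "\<forall>x. (f has_derivative f' x) (at x)" "\<forall>x. (g has_derivative g' x) (at x)"
    "\<forall>v. real_polynomial_function (\<lambda>x. f' x v)" "\<forall>v. real_polynomial_function (\<lambda>x. g' x v)"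
    by blast
  then show ?case
    by (intro exI[of _ "\<lambda>x v. f' x v + g' x v"])
       (auto intro!: derivative_intros real_polynomial_function.intros(3))
next
  case (mult f g)
  then obtain f' g' where "\<forall>x. (f has_derivative f' x) (at x)" "\<forall>x. (g has_derivative g' x) (at x)"
    "\<forall>v. real_polynomial_function (\<lambda>x. f' x v)" "\<forall>v. real_polynomial_function (\<lambda>x. g' x v)"
    by blast
  with mult.hyps show ?case
    by (intro exI[of _ "\<lambda>x v. f x * g' x v + f' x v * g x"])
       (auto intro!: derivative_intros real_polynomial_function.intros(3,4))
qed

text \<open>
  A class of functions that contains the cut-off functions needed below and is closed under
  partial derivatives; each of its members is therefore smooth.
\<close>

inductive flat_combination :: "('a::real_normed_vector \<Rightarrow> real) \<Rightarrow> bool"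
  where
    flat_term: "real_polynomial_function p \<Longrightarrow> real_polynomial_function q \<Longrightarrow>
      flat_combination (\<lambda>x. p x * flat n (q x))"
  | flat_add: "flat_combination f \<Longrightarrow> flat_combination g \<Longrightarrow> flat_combination (\<lambda>x. f x + g x)"

lemma flat_combination_has_derivative:
  assumes "flat_combination f"
  shows "\<exists>f'. (\<forall>x. (f has_derivative f' x) (at x)) \<and> (\<forall>v. flat_combination (\<lambda>x. f' x v))"
  using assms
proof induction
  case (flat_term p q n)
  obtain p' q' where p': "\<And>x. (p has_derivative p' x) (at x)"
      "\<And>v. real_polynomial_function (\<lambda>x. p' x v)"
    and q': "\<And>x. (q has_derivative q' x) (at x)" "\<And>v. real_polynomial_function (\<lambda>x. q' x v)"
    using flat_term real_polynomial_function_has_derivative by metis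
  let ?D = "\<lambda>x v. p x * q' x v * flat (n + 2) (q x) + (- real n * (p x * q' x v)) * flat (n + 1) (q x)
    + p' x v * flat n (q x)"
  have "((\<lambda>x. p x * flat n (q x)) has_derivative ?D x) (at x)" for x
  proof -
    have "((\<lambda>x. flat n (q x)) has_derivative
        (\<lambda>v. (flat (n + 2) (q x) - real n * flat (n + 1) (q x)) * q' x v)) (at x)"
      using has_derivative_compose[OF q'(1)[of x]
          flat_has_real_derivative[unfolded has_field_derivative_def]] .
    from has_derivative_mult[OF p'(1)[of x] this] show ?thesis
      by (rule has_derivative_eq_rhs) (auto simp: fun_eq_iff algebra_simps)
  qed
  moreover have "flat_combination (\<lambda>x. ?D x v)" for v
    by (intro flat_combination.intros real_polynomial_function.intros(2-) flat_term p' q')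
  ultimately show ?case by (intro exI[of _ ?D]) blast
next
  case (flat_add f g)
  then obtain f' g' where "\<forall>x. (f has_derivative f' x) (at x)" "\<forall>x. (g has_derivative g' x) (at x)"
    "\<forall>v. flat_combination (\<lambda>x. f' x v)" "\<forall>v. flat_combination (\<lambda>x. g' x v)"
    by blast
  then show ?case
    by (intro exI[of _ "\<lambda>x v. f' x v + g' x v"])
       (auto intro!: derivative_intros flat_combination.intros)
qed

lemma flat_combination_iter_partial:
  assumes "flat_combination f"
  shows "flat_combination (iter_partial \<alpha> f)"
proof (induction \<alpha>)
  case (Cons i \<alpha>)
  obtain f' where f': "\<And>x. (iter_partial \<alpha> f has_derivative f' x) (at x)"
      "\<And>v. flat_combination (\<lambda>x. f' x v)"
    using flat_combination_has_derivative[OF Cons] by blast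
  have "frechet_derivative (iter_partial \<alpha> f) (at x) = f' x" for x
    using frechet_derivative_at[OF f'(1)[of x]] by simp
  with f'(2) show ?case by simp
qed (use assms in simp)

lemma flat_combination_differentiable_on:
  "flat_combination f \<Longrightarrow> f differentiable_on UNIV"
  using flat_combination_has_derivative
  by (metis differentiable_at_imp_differentiable_on differentiable_def)

lemma flat_combination_sum:
  fixes g :: "'c \<Rightarrow> 'a::real_normed_vector \<Rightarrow> real"
  assumes "finite C" "\<And>c. c \<in> C \<Longrightarrow> flat_combination (g c)"
  shows "flat_combination (\<lambda>x. \<Sum>c\<in>C. g c x)"
  using assms
proof (induction C)
  case empty
  have "flat_combination (\<lambda>x::'a. 0 * flat 0 0)"
    by (intro flat_combination.intros real_polynomial_function.intros(2))
  then show ?case by simp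
next
  case (insert c C)
  then show ?case
    by (auto intro: flat_combination.intros)
qed

lemma real_polynomial_function_ball:
  fixes c :: "'a::euclidean_space"
  shows "real_polynomial_function (\<lambda>x. r\<^sup>2 - (dist c x)\<^sup>2)"
proof -
  have "(dist c x)\<^sup>2 = (\<Sum>b\<in>Basis. (c \<bullet> b + (-1) * (b \<bullet> x)) * (c \<bullet> b + (-1) * (b \<bullet> x)))" for x
    unfolding dist_norm power2_norm_eq_inner
    by (subst euclidean_inner) (simp add: inner_diff_left inner_diff_right inner_commute)
  then show ?thesis
    by (simp only:) (intro real_polynomial_function_diff real_polynomial_function_sum
        real_polynomial_function.intros(2-) real_polynomial_function.intros(1)
        bounded_linear_inner_right finite_Basis)
qed

text \<open>
  The bump function is a finite sum of flat functions of \<open>r\<^sup>2 - (dist c x)\<^sup>2\<close>, over balls that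
  cover \<open>K\<close>. It need not equal \<open>1\<close> on \<open>K\<close>: it is later divided out before a polynomial
  approximation is chosen.
\<close>

lemma bump_function_exists:
  fixes K :: "'a::euclidean_space set"
  assumes "compact K" "open \<Omega>" "K \<subseteq> \<Omega>"
  obtains \<beta> S where "\<And>p. real_polynomial_function p \<Longrightarrow> flat_combination (\<lambda>x. p x * \<beta> x)"
    "\<And>x. 0 \<le> \<beta> x" "\<And>x. x \<in> K \<Longrightarrow> 0 < \<beta> x" "compact S" "S \<subseteq> \<Omega>" "\<And>x. x \<notin> S \<Longrightarrow> \<beta> x = 0"
proof -
  have "\<forall>x\<in>K. \<exists>r>0. cball x r \<subseteq> \<Omega>"
    using assms open_contains_cball by blast
  then obtain r where r: "\<And>x. x \<in> K \<Longrightarrow> 0 < r x" "\<And>x. x \<in> K \<Longrightarrow> cball x (r x) \<subseteq> \<Omega>"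
    by metis
  obtain C where C: "C \<subseteq> K" "finite C" "K \<subseteq> (\<Union>c\<in>C. ball c (r c))"
    by (rule compactE_image[OF assms(1), of K "\<lambda>c. ball c (r c)"]) (use r in auto)
  define b where "b c x = flat 0 ((r c)\<^sup>2 - (dist c x)\<^sup>2)" for c x :: 'a
  have b0: "0 \<le> b c x" for c x
    by (simp add: b_def flat_def)
  have bpos: "0 < b c x" if "c \<in> C" "x \<in> ball c (r c)" for c x
    using that r(1)[of c] C(1) by (auto simp: b_def flat_def power_strict_mono)
  have bzero: "b c x = 0" if "c \<in> C" "x \<notin> cball c (r c)" for c x
  proof -
    have "(r c)\<^sup>2 \<le> (dist c x)\<^sup>2"
      using that r(1)[of c] C(1) by (intro power_mono) auto
    then show ?thesis by (simp add: b_def flat_def)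
  qed
  show ?thesis
  proof
    fix p :: "'a \<Rightarrow> real" assume p: "real_polynomial_function p"
    have "flat_combination (\<lambda>x. p x * b c x)" for c
      unfolding b_def by (intro flat_term p real_polynomial_function_ball)
    then show "flat_combination (\<lambda>x. p x * (\<Sum>c\<in>C. b c x))"
      unfolding sum_distrib_left by (intro flat_combination_sum C)
  next
    fix x show "0 \<le> (\<Sum>c\<in>C. b c x)"
      by (intro sum_nonneg b0)
  next
    fix x assume "x \<in> K"
    then obtain c where "c \<in> C" "x \<in> ball c (r c)"
      using C(3) by blast
    then show "0 < (\<Sum>c\<in>C. b c x)"
      using C(2) b0 bpos by (intro sum_pos2)
  next
    show "compact (\<Union>c\<in>C. cball c (r c))"
      using C(2) by auto
    show "(\<Union>c\<in>C. cball c (r c)) \<subseteq> \<Omega>"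
      using C(1) r(2) by blast
    show "(\<Sum>c\<in>C. b c x) = 0" if "x \<notin> (\<Union>c\<in>C. cball c (r c))" for x
      using that bzero by (intro sum.neutral) auto
  qed
qed

lemma flat_combination_test_function:
  assumes "flat_combination \<phi>" "compact S" "S \<subseteq> \<Omega>" "\<And>x. x \<notin> S \<Longrightarrow> \<phi> x = 0"
  shows "\<phi> \<in> test_functions \<Omega>"
proof -
  have sub: "closure {x. \<phi> x \<noteq> 0} \<subseteq> S"
    by (intro closure_minimal compact_imp_closed assms(2)) (use assms(4) in auto)
  then have "S \<inter> closure {x. \<phi> x \<noteq> 0} = closure {x. \<phi> x \<noteq> 0}"
    by blast
  then have "compact (closure {x. \<phi> x \<noteq> 0})"
    using compact_Int_closed[OF assms(2) closed_closure] by metis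
  moreover have "closure {x. \<phi> x \<noteq> 0} \<subseteq> \<Omega>"
    using sub assms(3) by blast
  ultimately show ?thesis
    using assms(1)
    by (simp add: test_functions_def flat_combination_iter_partial flat_combination_differentiable_on)
qed

lemma C0_small_off_compact:
  assumes "f \<in> C0 \<Omega>" "0 < e"
  shows "\<exists>K. compact K \<and> K \<subseteq> \<Omega> \<and> (\<forall>x\<in>\<Omega> - K. \<bar>f x\<bar> < e)"
  using assms by (simp add: C0_def)

text \<open>
  Subtracting from \<open>f\<close> its truncation to \<open>[-e, e]\<close> gives a function \<open>s\<close> that vanishes off a compact
  set on which some bump function \<open>\<beta>\<close> is positive. If a polynomial \<open>p\<close> is uniformly close to \<open>s / \<beta>\<close> on the support of \<open>\<beta>\<close>
  (Stone--Weierstrass), then \<open>p \<beta>\<close> is a test function close to \<open>s\<close>.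
\<close>

lemma test_functions_dense_C0:
  assumes "open \<Omega>" "f \<in> C0 \<Omega>" "0 < e"
  obtains \<phi> where "\<phi> \<in> test_functions \<Omega>" "\<And>x. \<bar>f x - \<phi> x\<bar> \<le> 2 * e"
proof -
  have cont: "continuous_on \<Omega> f" and f0: "\<And>x. x \<notin> \<Omega> \<Longrightarrow> f x = 0"
    using assms(2) by (auto simp: C0_def)
  obtain K where K: "compact K" "K \<subseteq> \<Omega>" "\<And>x. x \<in> \<Omega> - K \<Longrightarrow> \<bar>f x\<bar> < e"
    using C0_small_off_compact[OF assms(2,3)] by blast
  obtain \<beta> S where \<beta>: "\<And>p. real_polynomial_function p \<Longrightarrow> flat_combination (\<lambda>x. p x * \<beta> x)"
    "\<And>x. 0 \<le> \<beta> x" "\<And>x. x \<in> K \<Longrightarrow> 0 < \<beta> x" "compact S" "S \<subseteq> \<Omega>" "\<And>x. x \<notin> S \<Longrightarrow> \<beta> x = 0"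
    by (rule bump_function_exists[OF K(1) assms(1) K(2)]) (rule that)
  define s where "s x = f x - max (- e) (min e (f x))" for x
  define g where "g x = s x / \<beta> x" for x
  have small: "\<bar>f x\<bar> < e" if "x \<notin> K" for x
    using that K(3)[of x] f0[of x] assms(3) by (cases "x \<in> \<Omega>") auto
  have s0: "s x = 0" if "\<bar>f x\<bar> < e" for x
    using that by (auto simp: s_def)
  have contb: "continuous_on UNIV \<beta>"
    using \<beta>(1)[of "\<lambda>x. 1"] flat_combination_differentiable_on
    by (auto intro!: differentiable_imp_continuous_on real_polynomial_function.intros)
  have "continuous_on \<Omega> g"
  proof -
    \<comment> \<open>Where \<open>\<beta>\<close> may vanish, \<open>\<bar>f\<bar> < e\<close> and so \<open>g\<close> is \<open>0\<close>; two open sets suffice.\<close>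
    let ?A = "\<Omega> \<inter> \<beta> -` {0<..}" and ?B = "\<Omega> \<inter> (\<lambda>x. \<bar>f x\<bar>) -` {..<e}"
    have "open ?A"
      using continuous_open_preimage[OF continuous_on_subset[OF contb subset_UNIV] assms(1), of "{0<..}"]
      by simp
    moreover have "open ?B"
      by (intro continuous_open_preimage continuous_intros cont assms(1) open_lessThan)
    moreover have "continuous_on ?A g"
    proof -
      have fA: "continuous_on ?A f" and bA: "continuous_on ?A \<beta>"
        using cont contb continuous_on_subset by blast+
      show ?thesis
        unfolding g_def s_def by (intro continuous_intros fA bA) auto
    qed
    moreover have "continuous_on ?B g"
      by (rule continuous_on_eq[of _ "\<lambda>x. 0"]) (auto simp: g_def s0)
    ultimately have "continuous_on (?A \<union> ?B) g"
      by (rule continuous_on_open_Un)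
    moreover have "?A \<union> ?B = \<Omega>"
      using small \<beta>(3) by fastforce
    ultimately show ?thesis by simp
  qed
  then have "continuous_on S g"
    using \<beta>(5) continuous_on_subset by blast
  have "bounded (\<beta> ` S)"
    by (rule compact_imp_bounded[OF compact_continuous_image[OF
          continuous_on_subset[OF contb subset_UNIV] \<beta>(4)]])
  then obtain B where "0 < B" and "\<forall>y\<in>\<beta> ` S. norm y \<le> B"
    unfolding bounded_pos by blast
  then have B: "0 < B" "\<And>x. x \<in> S \<Longrightarrow> \<beta> x \<le> B"
    by (auto simp: abs_le_iff)
  obtain p where p: "real_polynomial_function p" "\<And>x. x \<in> S \<Longrightarrow> \<bar>g x - p x\<bar> < e / B"
    using Stone_Weierstrass_real_polynomial_function[OF \<beta>(4) \<open>continuous_on S g\<close>, of "e / B"]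
      B(1) assms(3) by auto
  show ?thesis
  proof
    show "(\<lambda>x. p x * \<beta> x) \<in> test_functions \<Omega>"
      by (rule flat_combination_test_function[OF \<beta>(1)[OF p(1)] \<beta>(4,5)]) (simp add: \<beta>(6))
  next
    fix x
    show "\<bar>f x - p x * \<beta> x\<bar> \<le> 2 * e"
    proof (cases "x \<in> S")
      case True
      have "g x * \<beta> x = s x"
        using small[of x] s0[of x] \<beta>(3)[of x] by (cases "x \<in> K") (auto simp: g_def)
      then have "\<bar>s x - p x * \<beta> x\<bar> = \<bar>g x - p x\<bar> * \<beta> x"
        using \<beta>(2)[of x] by (metis abs_mult abs_of_nonneg left_diff_distrib)
      also have "\<dots> \<le> e / B * B"
        using p(2)[OF True] B True \<beta>(2)[of x] by (intro mult_mono) auto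
      finally have "\<bar>s x - p x * \<beta> x\<bar> \<le> e"
        using B(1) by simp
      moreover have "\<bar>f x - s x\<bar> \<le> e"
        using assms(3) by (auto simp: s_def)
      ultimately show ?thesis by linarith
    next
      case False
      then show ?thesis
        using \<beta>(3,6)[of x] small[of x] assms(3) by force
    qed
  qed
qed

section \<open>Radon measures as functionals\<close>

lemma C0_abs_le_sup_norm:
  assumes "f \<in> C0 \<Omega>"
  shows "\<bar>f x\<bar> \<le> sup_norm f"
proof -
  obtain K where K: "compact K" "K \<subseteq> \<Omega>" "\<forall>x\<in>\<Omega> - K. \<bar>f x\<bar> < 1"
    using C0_small_off_compact[OF assms, of 1] by auto
  have cont: "continuous_on \<Omega> f" and f0: "\<And>x. x \<notin> \<Omega> \<Longrightarrow> f x = 0"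
    using assms by (auto simp: C0_def)
  have "bounded (f ` K)"
    by (rule compact_imp_bounded[OF compact_continuous_image[OF continuous_on_subset[OF cont K(2)] K(1)]])
  then obtain B where B: "0 < B" "\<forall>y\<in>f ` K. norm y \<le> B"
    unfolding bounded_pos by blast
  have "\<bar>f y\<bar> \<le> max B 1" for y
  proof -
    consider "y \<in> K" | "y \<in> \<Omega> - K" | "y \<notin> \<Omega>" by blast
    then show ?thesis
    proof cases
      case 1
      then have "\<bar>f y\<bar> \<le> B" using B(2) by auto
      then show ?thesis by simp
    next
      case 2
      then have "\<bar>f y\<bar> < 1" using K(3) by blast
      then show ?thesis by simp
    next
      case 3
      then show ?thesis by (simp add: f0)
    qed
  qed
  then have "bdd_above (range (\<lambda>y. \<bar>f y\<bar>))"
    by (rule bdd_aboveI2)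
  then show ?thesis
    unfolding sup_norm_def by (rule cSUP_upper[OF UNIV_I])
qed

lemma sup_norm_least:
  "(\<And>x. \<bar>f x\<bar> \<le> c) \<Longrightarrow> sup_norm f \<le> c"
  unfolding sup_norm_def by (rule cSUP_least) auto

lemma C0_sup_norm_nonneg: "f \<in> C0 \<Omega> \<Longrightarrow> 0 \<le> sup_norm f"
  using C0_abs_le_sup_norm[of f \<Omega> undefined] by linarith

lemma subspace_C0: "subspace (C0 \<Omega>)"
proof (rule subspaceI)
  show "0 \<in> C0 \<Omega>"
    by (auto simp: C0_def zero_fun_def intro: exI[of _ "{}"])
next
  fix f g assume fg: "f \<in> C0 \<Omega>" "g \<in> C0 \<Omega>"
  have "\<exists>K. compact K \<and> K \<subseteq> \<Omega> \<and> (\<forall>x\<in>\<Omega> - K. \<bar>(f + g) x\<bar> < e)" if "0 < e" for e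
  proof -
    have "0 < e / 2" using that by simp
    then obtain K1 K2 where "compact K1" "K1 \<subseteq> \<Omega>" "\<forall>x\<in>\<Omega> - K1. \<bar>f x\<bar> < e / 2"
      "compact K2" "K2 \<subseteq> \<Omega>" "\<forall>x\<in>\<Omega> - K2. \<bar>g x\<bar> < e / 2"
      using C0_small_off_compact[OF fg(1)] C0_small_off_compact[OF fg(2)] by meson
    then show ?thesis
      by (intro exI[of _ "K1 \<union> K2"]) (force simp: compact_Un)
  qed
  with fg show "f + g \<in> C0 \<Omega>"
    by (auto simp: C0_def plus_fun_def intro: continuous_on_add)
next
  fix f and c :: real assume f: "f \<in> C0 \<Omega>"
  have "\<exists>K. compact K \<and> K \<subseteq> \<Omega> \<and> (\<forall>x\<in>\<Omega> - K. \<bar>(c *\<^sub>R f) x\<bar> < e)" if "0 < e" for e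
  proof -
    have "0 < e / (\<bar>c\<bar> + 1)" using that by simp
    then obtain K where K: "compact K" "K \<subseteq> \<Omega>" "\<forall>x\<in>\<Omega> - K. \<bar>f x\<bar> < e / (\<bar>c\<bar> + 1)"
      using C0_small_off_compact[OF f] by meson
    have "\<bar>c * f x\<bar> < e" if "x \<in> \<Omega> - K" for x
    proof -
      have "\<bar>c * f x\<bar> \<le> (\<bar>c\<bar> + 1) * \<bar>f x\<bar>"
        by (simp add: abs_mult mult_right_mono)
      also have "\<dots> < e"
        using K(3) that by (auto simp: field_simps)
      finally show ?thesis .
    qed
    with K show ?thesis
      by (intro exI[of _ K]) (auto simp: scaleR_fun_def)
  qed
  with f show "c *\<^sub>R f \<in> C0 \<Omega>"
    by (auto simp: C0_def scaleR_fun_def intro: continuous_on_mult)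
qed

lemma test_functions_subset_C0: "test_functions \<Omega> \<subseteq> C0 \<Omega>"
proof
  fix \<phi> assume \<phi>: "\<phi> \<in> test_functions \<Omega>"
  let ?K = "closure {x. \<phi> x \<noteq> 0}"
  from \<phi> have K: "compact ?K" "?K \<subseteq> \<Omega>" and "iter_partial [] \<phi> differentiable_on UNIV"
    by (auto simp only: test_functions_def mem_Collect_eq)
  then have cont: "continuous_on UNIV \<phi>"
    by (auto intro: differentiable_imp_continuous_on)
  have off: "\<phi> x = 0" if "x \<notin> ?K" for x
    using that closure_subset[of "{x. \<phi> x \<noteq> 0}"] by blast
  have "\<exists>C. compact C \<and> C \<subseteq> \<Omega> \<and> (\<forall>x\<in>\<Omega> - C. \<bar>\<phi> x\<bar> < e)" if "0 < e" for e
  proof (intro exI[of _ ?K] conjI ballI K)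
    show "\<bar>\<phi> x\<bar> < e" if "x \<in> \<Omega> - ?K" for x
      using off[of x] that \<open>0 < e\<close> by simp
  qed
  moreover have "\<phi> x = 0" if "x \<notin> \<Omega>" for x
    using that K(2) off by blast
  moreover have "continuous_on \<Omega> \<phi>"
    using cont by (rule continuous_on_subset) simp
  ultimately show "\<phi> \<in> C0 \<Omega>"
    by (simp add: C0_def)
qed

lemma sum_fun_apply: "(\<Sum>i\<in>I. g i) x = (\<Sum>i\<in>I. g i x)" for g :: "'i \<Rightarrow> 'a \<Rightarrow> 'b::comm_monoid_add"
  by (induction I rule: infinite_finite_induct) auto

lemma linear_on_sum:
  assumes "linear_on X T" "subspace X" "finite I" "\<And>i. i \<in> I \<Longrightarrow> x i \<in> X"
  shows "T (\<Sum>i\<in>I. c i *\<^sub>R x i) = (\<Sum>i\<in>I. c i *\<^sub>R T (x i))"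
  using assms(3,4)
proof (induction I)
  case empty
  have "T (0 *\<^sub>R 0) = 0 *\<^sub>R T 0"
    using assms(1) subspace_0[OF assms(2)] unfolding linear_on_def by blast
  then show ?case by simp
next
  case (insert i I)
  have "(\<Sum>i\<in>I. c i *\<^sub>R x i) \<in> X" "c i *\<^sub>R x i \<in> X"
    using insert.prems assms(2) by (auto intro!: subspace_sum subspace_scale)
  with insert assms(1) show ?case
    by (simp add: linear_on_def)
qed

lemma linear_on_diff:
  assumes "linear_on X T" "subspace X" "x \<in> X" "y \<in> X"
  shows "T (x - y) = T x - T y"
proof -
  have "T (x - y + y) = T (x - y) + T y"
    using assms subspace_diff[OF assms(2-4)] unfolding linear_on_def by blast
  then show ?thesis by simp
qed

lemma subspace_dual_space: "subspace (dual_space X N)"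
proof (rule subspaceI)
  show "0 \<in> dual_space X N"
    by (auto simp: dual_space_def linear_on_def zero_fun_def intro: exI[of _ 0])
next
  fix f g assume "f \<in> dual_space X N" "g \<in> dual_space X N"
  then obtain C D where fg: "linear_on X f" "linear_on X g"
    "\<forall>x. x \<notin> X \<longrightarrow> f x = 0" "\<forall>x. x \<notin> X \<longrightarrow> g x = 0"
    "\<forall>x\<in>X. \<bar>f x\<bar> \<le> C * N x" "\<forall>x\<in>X. \<bar>g x\<bar> \<le> D * N x"
    unfolding dual_space_def by blast
  have "\<bar>(f + g) x\<bar> \<le> (C + D) * N x" if "x \<in> X" for x
    using fg(5,6) that abs_triangle_ineq[of "f x" "g x"] by (fastforce simp: distrib_right)
  then have "\<exists>C. \<forall>x\<in>X. \<bar>(f + g) x\<bar> \<le> C * N x"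
    by blast
  moreover have "linear_on X (f + g)"
    using fg(1,2) by (simp add: linear_on_def algebra_simps)
  ultimately show "f + g \<in> dual_space X N"
    using fg(3,4) by (simp add: dual_space_def)
next
  fix f and c :: real assume "f \<in> dual_space X N"
  then obtain C where f: "linear_on X f" "\<forall>x. x \<notin> X \<longrightarrow> f x = 0" "\<forall>x\<in>X. \<bar>f x\<bar> \<le> C * N x"
    unfolding dual_space_def by blast
  have "\<bar>(c *\<^sub>R f) x\<bar> \<le> (\<bar>c\<bar> * C) * N x" if "x \<in> X" for x
    using mult_left_mono[of "\<bar>f x\<bar>" "C * N x" "\<bar>c\<bar>"] f(3) that
    by (simp add: scaleR_fun_def abs_mult mult.assoc)
  then have "\<exists>C. \<forall>x\<in>X. \<bar>(c *\<^sub>R f) x\<bar> \<le> C * N x"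
    by blast
  moreover have "linear_on X (c *\<^sub>R f)"
    using f(1) by (simp add: linear_on_def scaleR_fun_def algebra_simps)
  ultimately show "c *\<^sub>R f \<in> dual_space X N"
    using f(2) by (simp add: dual_space_def scaleR_fun_def)
qed

lemma subspace_radon: "subspace (radon \<Omega>)"
  unfolding radon_def by (rule subspace_dual_space)

lemma radon_linear_on: "\<mu> \<in> radon \<Omega> \<Longrightarrow> linear_on (C0 \<Omega>) \<mu>"
  by (simp add: radon_def dual_space_def)

lemma radon_abs_le_tv_norm_unit_ball:
  assumes "\<mu> \<in> radon \<Omega>" "f \<in> C0 \<Omega>" "sup_norm f \<le> 1"
  shows "\<bar>\<mu> f\<bar> \<le> tv_norm \<Omega> \<mu>"
proof -
  obtain C where C: "\<And>g. g \<in> C0 \<Omega> \<Longrightarrow> \<bar>\<mu> g\<bar> \<le> C * sup_norm g"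
    using assms(1) unfolding radon_def dual_space_def by blast
  have "bdd_above ((\<lambda>h. \<bar>\<mu> h\<bar>) ` {h \<in> C0 \<Omega>. sup_norm h \<le> 1})"
  proof (rule bdd_aboveI2)
    fix h assume "h \<in> {h \<in> C0 \<Omega>. sup_norm h \<le> 1}"
    then have h: "h \<in> C0 \<Omega>" "sup_norm h \<le> 1" by auto
    have "C * sup_norm h \<le> \<bar>C\<bar> * 1"
      using h(2) C0_sup_norm_nonneg[OF h(1)] by (intro mult_mono) auto
    with C[OF h(1)] show "\<bar>\<mu> h\<bar> \<le> \<bar>C\<bar>" by simp
  qed
  then show ?thesis
    unfolding tv_norm_def dual_norm_def
    by (rule cSUP_upper[rotated]) (use assms in simp)
qed

lemma radon_abs_le_tv_norm:
  assumes "\<mu> \<in> radon \<Omega>" "f \<in> C0 \<Omega>"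
  shows "\<bar>\<mu> f\<bar> \<le> tv_norm \<Omega> \<mu> * sup_norm f"
proof -
  obtain C where C: "\<And>g. g \<in> C0 \<Omega> \<Longrightarrow> \<bar>\<mu> g\<bar> \<le> C * sup_norm g"
    using assms(1) unfolding radon_def dual_space_def by blast
  show ?thesis
  proof (cases "sup_norm f = 0")
    case True
    then show ?thesis using C[OF assms(2)] by simp
  next
    case False
    then have pos: "0 < sup_norm f"
      using C0_sup_norm_nonneg[OF assms(2)] by linarith
    define g where "g = (1 / sup_norm f) *\<^sub>R f"
    have g: "g \<in> C0 \<Omega>"
      unfolding g_def by (intro subspace_scale subspace_C0 assms(2))
    have "sup_norm g \<le> 1"
      using C0_abs_le_sup_norm[OF assms(2)] pos
      by (intro sup_norm_least) (simp add: g_def scaleR_fun_def abs_mult field_simps)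
    have "\<bar>\<mu> g\<bar> \<le> tv_norm \<Omega> \<mu>"
      by (rule radon_abs_le_tv_norm_unit_ball[OF assms(1) g \<open>sup_norm g \<le> 1\<close>])
    moreover have "\<mu> g = \<mu> f / sup_norm f"
      using radon_linear_on[OF assms(1)] assms(2) by (simp add: g_def linear_on_def)
    ultimately show ?thesis
      using pos by (simp add: field_simps)
  qed
qed

lemma tv_norm_le:
  assumes "0 \<le> M" "\<And>f. f \<in> C0 \<Omega> \<Longrightarrow> \<bar>\<mu> f\<bar> \<le> M * sup_norm f"
  shows "tv_norm \<Omega> \<mu> \<le> M"
  unfolding tv_norm_def dual_norm_def
proof (rule cSUP_least)
  have "sup_norm (0 :: real^'a \<Rightarrow> real) \<le> 1"
    by (rule sup_norm_least) simp
  then show "{f \<in> C0 \<Omega>. sup_norm f \<le> 1} \<noteq> {}"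
    using subspace_0[OF subspace_C0[of \<Omega>]] by blast
next
  fix f assume "f \<in> {f \<in> C0 \<Omega>. sup_norm f \<le> 1}"
  then have "\<bar>\<mu> f\<bar> \<le> M * sup_norm f" "M * sup_norm f \<le> M * 1"
    using assms by (blast, intro mult_left_mono) auto
  then show "\<bar>\<mu> f\<bar> \<le> M" by simp
qed

lemma tv_norm_nonneg:
  assumes "\<mu> \<in> radon \<Omega>"
  shows "0 \<le> tv_norm \<Omega> \<mu>"
proof -
  have "sup_norm (0 :: real^'a \<Rightarrow> real) \<le> 1"
    by (rule sup_norm_least) simp
  then have "\<bar>\<mu> 0\<bar> \<le> tv_norm \<Omega> \<mu>"
    by (rule radon_abs_le_tv_norm_unit_ball[OF assms subspace_0[OF subspace_C0]])
  then show ?thesis by linarith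
qed

lemma delta_radon: "delta \<Omega> v \<in> radon \<Omega>"
proof -
  have "\<forall>f\<in>C0 \<Omega>. \<bar>delta \<Omega> v f\<bar> \<le> 1 * sup_norm f"
    using C0_abs_le_sup_norm C0_sup_norm_nonneg by (fastforce simp: delta_def)
  moreover have "linear_on (C0 \<Omega>) (delta \<Omega> v)"
    using subspace_add[OF subspace_C0[of \<Omega>]] subspace_scale[OF subspace_C0[of \<Omega>]]
    by (auto simp: linear_on_def delta_def scaleR_fun_def)
  ultimately show ?thesis
    unfolding radon_def dual_space_def mem_Collect_eq
    by (intro conjI exI[of _ 1]) (auto simp: delta_def)
qed

lemma delta_apply: "f \<in> C0 \<Omega> \<Longrightarrow> delta \<Omega> v f = f v"
  by (auto simp: delta_def C0_def)

text \<open>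
  A Radon measure is determined by its action on test functions, because these are dense in
  \<open>C0 \<Omega>\<close>. Without this, \<^const>\<open>op_BM\<close>, which reads off the measure from a distribution, would not
  be well defined, let alone linear.
\<close>

lemma inj_on_dist_of_radon:
  assumes "open \<Omega>"
  shows "inj_on (dist_of_radon \<Omega>) (radon \<Omega>)"
proof (rule inj_onI)
  fix \<mu> \<nu> assume \<mu>: "\<mu> \<in> radon \<Omega>" and \<nu>: "\<nu> \<in> radon \<Omega>"
    and eq: "dist_of_radon \<Omega> \<mu> = dist_of_radon \<Omega> \<nu>"
  define \<kappa> where "\<kappa> = \<mu> - \<nu>"
  have \<kappa>: "\<kappa> \<in> radon \<Omega>"
    unfolding \<kappa>_def by (intro subspace_diff subspace_radon \<mu> \<nu>)
  have \<kappa>0: "\<kappa> \<phi> = 0" if "\<phi> \<in> test_functions \<Omega>" for \<phi>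
    using fun_cong[OF eq, of \<phi>] that by (simp add: \<kappa>_def dist_of_radon_def)
  have "\<kappa> f = 0" if f: "f \<in> C0 \<Omega>" for f
  proof -
    have "\<bar>\<kappa> f\<bar> \<le> e" if "0 < e" for e
    proof -
      define \<delta> where "\<delta> = e / (2 * (tv_norm \<Omega> \<kappa> + 1))"
      have tv: "0 \<le> tv_norm \<Omega> \<kappa>"
        by (rule tv_norm_nonneg[OF \<kappa>])
      then have "0 < \<delta>"
        using \<open>0 < e\<close> by (simp add: \<delta>_def)
      obtain \<phi> where \<phi>: "\<phi> \<in> test_functions \<Omega>" "\<And>x. \<bar>f x - \<phi> x\<bar> \<le> 2 * \<delta>"
        by (rule test_functions_dense_C0[OF assms f \<open>0 < \<delta>\<close>]) (rule that)
      then have \<phi>C: "\<phi> \<in> C0 \<Omega>"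
        using test_functions_subset_C0 by blast
      have "\<kappa> f = \<kappa> (f - \<phi>)"
        using linear_on_diff[OF radon_linear_on[OF \<kappa>] subspace_C0 f \<phi>C] \<kappa>0[OF \<phi>(1)] by simp
      also have "\<bar>\<dots>\<bar> \<le> tv_norm \<Omega> \<kappa> * sup_norm (f - \<phi>)"
        by (intro radon_abs_le_tv_norm \<kappa> subspace_diff subspace_C0 f \<phi>C)
      also have "\<dots> \<le> tv_norm \<Omega> \<kappa> * (2 * \<delta>)"
        using \<phi>(2) by (intro mult_left_mono tv sup_norm_least) simp
      also have "\<dots> \<le> e"
        using tv \<open>0 < e\<close> by (simp add: \<delta>_def field_simps)
      finally show ?thesis .
    qed
    then have "\<bar>\<kappa> f\<bar> \<le> 0"
      by (rule field_le_epsilon) simp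
    then show ?thesis by simp
  qed
  moreover have "\<kappa> f = 0" if "f \<notin> C0 \<Omega>" for f
    using \<kappa> that by (simp add: radon_def dual_space_def)
  ultimately have "\<kappa> = 0"
    by (auto simp: fun_eq_iff)
  then show "\<mu> = \<nu>"
    by (simp add: \<kappa>_def)
qed

section \<open>Reduction to a discrete measure\<close>

text \<open>
  A polytope is the convex hull of its extreme points, and \<open>{y. \<bar>c \<bullet> y + b\<bar> \<le> m}\<close> is convex.
\<close>

lemma affine_on_polytope_abs_le:
  fixes P :: "(real^'d) set"
  assumes "polytope P" "affine_on P g" "\<And>v. v extreme_point_of P \<Longrightarrow> \<bar>g v\<bar> \<le> m" "x \<in> P"
  shows "\<bar>g x\<bar> \<le> m"
proof -
  obtain c b where g: "\<And>y. y \<in> P \<Longrightarrow> g y = c \<bullet> y + b"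
    using assms(2) unfolding affine_on_def by blast
  have "{y. \<bar>c \<bullet> y + b\<bar> \<le> m} = {y. c \<bullet> y \<le> m - b} \<inter> {y. c \<bullet> y \<ge> - m - b}"
    by auto
  then have "convex {y. \<bar>c \<bullet> y + b\<bar> \<le> m}"
    by (simp add: convex_Int convex_halfspace_le convex_halfspace_ge)
  moreover have "{v. v extreme_point_of P} \<subseteq> {y. \<bar>c \<bullet> y + b\<bar> \<le> m}"
    using assms(3) g by (auto simp: extreme_point_of_def)
  ultimately have "convex hull {v. v extreme_point_of P} \<subseteq> {y. \<bar>c \<bullet> y + b\<bar> \<le> m}"
    by (rule hull_minimal[rotated])
  moreover have "P = convex hull {v. v extreme_point_of P}"
    by (intro Krein_Milman_Minkowski polytope_imp_compact polytope_imp_convex assms(1))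
  ultimately have "x \<in> {y. \<bar>c \<bullet> y + b\<bar> \<le> m}"
    using assms(4) by blast
  then show ?thesis
    using g[OF assms(4)] by simp
qed

lemma affine_on_sum:
  assumes "finite I" "\<And>i. i \<in> I \<Longrightarrow> affine_on P (g i)"
  shows "affine_on P (\<lambda>x. \<Sum>i\<in>I. q i * g i x)"
proof -
  have "\<forall>i\<in>I. \<exists>c b. \<forall>x\<in>P. g i x = c \<bullet> x + b"
    using assms(2) by (simp add: affine_on_def)
  then obtain c b where cb: "\<And>i x. i \<in> I \<Longrightarrow> x \<in> P \<Longrightarrow> g i x = c i \<bullet> x + b i"
    by metis
  then have "(\<Sum>i\<in>I. q i * g i x) = (\<Sum>i\<in>I. q i *\<^sub>R c i) \<bullet> x + (\<Sum>i\<in>I. q i * b i)" if "x \<in> P" for x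
    using that by (simp add: inner_sum_left sum.distrib algebra_simps)
  then show ?thesis
    unfolding affine_on_def by blast
qed

lemma finite_vertices:
  assumes "polyhedral_pieces \<Omega> \<P>"
  shows "finite (vertices \<P>)"
proof -
  have "vertices \<P> = (\<Union>P\<in>\<P>. {v. v extreme_point_of P})"
    by (auto simp: vertices_def)
  moreover have "finite (\<Union>P\<in>\<P>. {v. v extreme_point_of P})"
    using assms by (auto simp: polyhedral_pieces_def
        intro: finite_polyhedron_extreme_points polytope_imp_polyhedron)
  ultimately show ?thesis by simp
qed

text \<open>
  The maximum principle that makes vertices suffice: the sup norm of a piecewise affine function
  is attained at a vertex.
\<close>

lemma piecewise_affine_abs_le:
  assumes "polyhedral_pieces \<Omega> \<P>" "\<And>P. P \<in> \<P> \<Longrightarrow> affine_on P g" "\<And>x. x \<notin> \<Omega> \<Longrightarrow> g x = 0"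
    "\<And>v. v \<in> vertices \<P> \<Longrightarrow> \<bar>g v\<bar> \<le> m" "0 \<le> m"
  shows "\<bar>g x\<bar> \<le> m"
proof (cases "x \<in> \<Omega>")
  case True
  then obtain P where "P \<in> \<P>" "x \<in> P"
    using assms(1) closure_subset[of \<Omega>] unfolding polyhedral_pieces_def by blast
  with assms(1,2,4) show ?thesis
    by (intro affine_on_polytope_abs_le[of P g m x])
       (auto simp: polyhedral_pieces_def vertices_def)
next
  case False
  then show ?thesis using assms(3,5) by simp
qed

text \<open>
  This is a finite-dimensional Hahn--Banach argument. The set of \<open>y\<close> of the claimed form is convex,
  so it contains the convex hull of \<open>0\<close> and the points \<open>\<plusminus>M r(v)\<close>, which is compact. A \<open>y\<close> outside this hull is
  strictly separated from it by a hyperplane, whose normal violates the assumed bound.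
\<close>

lemma l1_bounded_combination_if_functionals_bounded:
  fixes r :: "'v \<Rightarrow> 'a::euclidean_space"
  assumes "finite I" "0 \<le> M"
    and bound: "\<And>q m. 0 \<le> m \<Longrightarrow> (\<And>v. v \<in> I \<Longrightarrow> \<bar>q \<bullet> r v\<bar> \<le> m) \<Longrightarrow> q \<bullet> y \<le> M * m"
  shows "\<exists>d. y = (\<Sum>v\<in>I. d v *\<^sub>R r v) \<and> (\<Sum>v\<in>I. \<bar>d v\<bar>) \<le> M"
proof -
  define T where "T = {\<Sum>v\<in>I. d v *\<^sub>R r v | d. (\<Sum>v\<in>I. \<bar>d v\<bar>) \<le> M}"
  define G where "G = insert 0 ((\<lambda>v. M *\<^sub>R r v) ` I \<union> (\<lambda>v. (- M) *\<^sub>R r v) ` I)"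
  have "convex T"
  proof (rule convexI)
    fix x z and s t :: real
    assume "x \<in> T" "z \<in> T" and st: "0 \<le> s" "0 \<le> t" "s + t = 1"
    then obtain d e where d: "x = (\<Sum>v\<in>I. d v *\<^sub>R r v)" "(\<Sum>v\<in>I. \<bar>d v\<bar>) \<le> M"
      and e: "z = (\<Sum>v\<in>I. e v *\<^sub>R r v)" "(\<Sum>v\<in>I. \<bar>e v\<bar>) \<le> M"
      unfolding T_def by blast
    have "(\<Sum>v\<in>I. \<bar>s * d v + t * e v\<bar>) \<le> (\<Sum>v\<in>I. s * \<bar>d v\<bar> + t * \<bar>e v\<bar>)"
      using st by (intro sum_mono order_trans[OF abs_triangle_ineq]) (simp add: abs_mult)
    also have "\<dots> = s * (\<Sum>v\<in>I. \<bar>d v\<bar>) + t * (\<Sum>v\<in>I. \<bar>e v\<bar>)"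
      by (simp add: sum.distrib sum_distrib_left)
    also have "\<dots> \<le> s * M + t * M"
      using d(2) e(2) st by (intro add_mono mult_left_mono)
    also have "\<dots> = M"
      using st(3) by (simp flip: distrib_right)
    finally have "(\<Sum>v\<in>I. \<bar>s * d v + t * e v\<bar>) \<le> M" .
    moreover have "s *\<^sub>R x + t *\<^sub>R z = (\<Sum>v\<in>I. (s * d v + t * e v) *\<^sub>R r v)"
      by (simp add: d e scaleR_sum_right sum.distrib scaleR_add_left)
    ultimately show "s *\<^sub>R x + t *\<^sub>R z \<in> T"
      unfolding T_def mem_Collect_eq by (intro exI[of _ "\<lambda>v. s * d v + t * e v"]) simp
  qed
  moreover have "G \<subseteq> T"
  proof -
    have "0 \<in> T"
      unfolding T_def mem_Collect_eq using assms(2) by (intro exI[of _ "\<lambda>v. 0"]) simp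
    moreover have "c *\<^sub>R r v \<in> T" if "v \<in> I" "\<bar>c\<bar> \<le> M" for v c
      unfolding T_def mem_Collect_eq using assms(1) that
      by (intro exI[of _ "\<lambda>w. if w = v then c else 0"])
         (simp add: if_distrib[of abs] if_distrib[of "\<lambda>c. c *\<^sub>R _"] cong: if_cong)
    ultimately show ?thesis
      using assms(2) by (auto simp: G_def simp del: scaleR_minus_left)
  qed
  ultimately have hull: "convex hull G \<subseteq> T"
    by (rule hull_minimal[rotated])
  have "y \<in> convex hull G"
  proof (rule ccontr)
    assume y: "y \<notin> convex hull G"
    have "finite G"
      using assms(1) by (simp add: G_def)
    then have "closed (convex hull G)"
      by (simp add: finite_imp_compact_convex_hull compact_imp_closed)
    then obtain c b where c: "c \<bullet> y < b" "\<And>x. x \<in> convex hull G \<Longrightarrow> b < c \<bullet> x"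
      using separating_hyperplane_closed_point[OF convex_convex_hull _ y] by blast
    have cG: "b < c \<bullet> x" if "x \<in> G" for x
      using that c(2) hull_inc by metis
    have b: "b < 0"
      using cG[of 0] by (simp add: G_def)
    have vb: "M * \<bar>c \<bullet> r v\<bar> \<le> - b" if "v \<in> I" for v
    proof -
      have "b < M * (c \<bullet> r v)" "b < - (M * (c \<bullet> r v))"
        using cG[of "M *\<^sub>R r v"] cG[of "(- M) *\<^sub>R r v"] that by (auto simp: G_def)
      then show ?thesis by (cases "0 \<le> c \<bullet> r v") auto
    qed
    show False
    proof (cases "M = 0")
      case True
      \<comment> \<open>Any upper bound \<open>m\<close> will do here, since it is multiplied by \<open>M = 0\<close>.\<close>
      define m where "m = (\<Sum>v\<in>I. \<bar>(- c) \<bullet> r v\<bar>)"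
      have "(- c) \<bullet> y \<le> M * m"
        using assms(1) by (intro bound) (auto simp: m_def intro: sum_nonneg member_le_sum)
      then show False
        using True b c(1) by simp
    next
      case False
      then have "0 < M" using assms(2) by simp
      have "(- c) \<bullet> y \<le> M * (- b / M)"
        using b vb \<open>0 < M\<close> by (intro bound) (auto simp: field_simps)
      then show False
        using c(1) \<open>0 < M\<close> by simp
    qed
  qed
  with hull have "y \<in> T" by blast
  then show ?thesis
    unfolding T_def by blast
qed

text \<open>
  The functional \<open>\<mu>\<close> restricted to the span of the \<open>\<rho> i\<close> is bounded by the total variation of \<open>\<mu>\<close>
  times the maximum over the vertices. Hence the vector of its values on the \<open>\<rho> i\<close> is a
  combination of the vectors \<open>(\<rho> i v)\<^sub>i\<close>, with weights whose absolute sum is at most that total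
  variation. The weights define the discrete measure; a vertex outside \<open>\<Omega>\<close> causes no
  discrepancy, because both \<open>delta \<Omega> v\<close> and \<open>\<rho> i v\<close> are then \<open>0\<close>.
\<close>

lemma radon_discretization:
  fixes \<rho> :: "'m::finite \<Rightarrow> real^'d \<Rightarrow> real"
  assumes "\<mu> \<in> radon \<Omega>" "\<And>i. \<rho> i \<in> C0 \<Omega>" "polyhedral_pieces \<Omega> \<P>"
    "\<And>i P. P \<in> \<P> \<Longrightarrow> affine_on P (\<rho> i)"
  obtains d where "\<And>i. (\<Sum>v\<in>vertices \<P>. d v *\<^sub>R delta \<Omega> v) (\<rho> i) = \<mu> (\<rho> i)"
    "tv_norm \<Omega> (\<Sum>v\<in>vertices \<P>. d v *\<^sub>R delta \<Omega> v) \<le> tv_norm \<Omega> \<mu>"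
proof -
  let ?r = "\<lambda>v. \<chi> i. \<rho> i v" and ?y = "\<chi> i. \<mu> (\<rho> i)"
  have bound: "q \<bullet> ?y \<le> tv_norm \<Omega> \<mu> * m"
    if m: "0 \<le> m" "\<And>v. v \<in> vertices \<P> \<Longrightarrow> \<bar>q \<bullet> ?r v\<bar> \<le> m" for q :: "real^'m" and m
  proof -
    define g where "g = (\<Sum>i\<in>UNIV. q $ i *\<^sub>R \<rho> i)"
    have g_apply: "g x = (\<Sum>i\<in>UNIV. q $ i * \<rho> i x)" for x
      by (simp add: g_def scaleR_fun_def sum_fun_apply)
    have gC: "g \<in> C0 \<Omega>"
      unfolding g_def by (intro subspace_sum subspace_scale subspace_C0 assms(2))
    have "\<bar>g x\<bar> \<le> m" for x
    proof (rule piecewise_affine_abs_le[OF assms(3) _ _ _ m(1)])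
      show "affine_on P g" if "P \<in> \<P>" for P
      proof -
        have "g = (\<lambda>x. \<Sum>i\<in>UNIV. q $ i * \<rho> i x)"
          by (rule ext) (rule g_apply)
        then show ?thesis
          using affine_on_sum[of UNIV P \<rho> "($) q"] assms(4)[OF that] by simp
      qed
      show "g x = 0" if "x \<notin> \<Omega>" for x
        using gC that by (simp add: C0_def)
      show "\<bar>g v\<bar> \<le> m" if "v \<in> vertices \<P>" for v
        using m(2)[OF that] by (simp add: g_apply inner_vec_def)
    qed
    then have "sup_norm g \<le> m"
      by (rule sup_norm_least)
    have "q \<bullet> ?y = \<mu> g"
      unfolding g_def
      by (subst linear_on_sum[OF radon_linear_on[OF assms(1)] subspace_C0])
         (simp_all add: assms(2) inner_vec_def)
    also have "\<dots> \<le> tv_norm \<Omega> \<mu> * sup_norm g"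
      using radon_abs_le_tv_norm[OF assms(1) gC] by simp
    also have "\<dots> \<le> tv_norm \<Omega> \<mu> * m"
      by (intro mult_left_mono \<open>sup_norm g \<le> m\<close> tv_norm_nonneg assms(1))
    finally show ?thesis .
  qed
  have "\<exists>d. ?y = (\<Sum>v\<in>vertices \<P>. d v *\<^sub>R ?r v) \<and>
      (\<Sum>v\<in>vertices \<P>. \<bar>d v\<bar>) \<le> tv_norm \<Omega> \<mu>"
  proof (rule l1_bounded_combination_if_functionals_bounded[OF finite_vertices[OF assms(3)]
        tv_norm_nonneg[OF assms(1)]])
    fix q :: "real^'m" and m :: real
    assume "0 \<le> m" "\<And>v. v \<in> vertices \<P> \<Longrightarrow> \<bar>q \<bullet> ?r v\<bar> \<le> m"
    then show "q \<bullet> ?y \<le> tv_norm \<Omega> \<mu> * m"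
      by (rule bound)
  qed
  then obtain d where d: "?y = (\<Sum>v\<in>vertices \<P>. d v *\<^sub>R ?r v)"
      "(\<Sum>v\<in>vertices \<P>. \<bar>d v\<bar>) \<le> tv_norm \<Omega> \<mu>"
    by blast
  let ?\<nu> = "\<Sum>v\<in>vertices \<P>. d v *\<^sub>R delta \<Omega> v"
  have \<nu>_apply: "?\<nu> g = (\<Sum>v\<in>vertices \<P>. d v * g v)" if "g \<in> C0 \<Omega>" for g
    using that by (simp add: sum_fun_apply scaleR_fun_def delta_apply)
  show ?thesis
  proof
    fix i
    have "?y $ i = (\<Sum>v\<in>vertices \<P>. d v *\<^sub>R ?r v) $ i"
      by (simp only: d(1))
    then show "?\<nu> (\<rho> i) = \<mu> (\<rho> i)"
      by (simp add: \<nu>_apply assms(2))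
  next
    have "\<bar>?\<nu> g\<bar> \<le> (\<Sum>v\<in>vertices \<P>. \<bar>d v\<bar>) * sup_norm g" if "g \<in> C0 \<Omega>" for g
      unfolding \<nu>_apply[OF that] sum_distrib_right
      by (intro order_trans[OF sum_abs] sum_mono)
         (simp add: abs_mult mult_left_mono C0_abs_le_sup_norm[OF that])
    then have "tv_norm \<Omega> ?\<nu> \<le> (\<Sum>v\<in>vertices \<P>. \<bar>d v\<bar>)"
      by (intro tv_norm_le sum_nonneg) auto
    with d(2) show "tv_norm \<Omega> ?\<nu> \<le> tv_norm \<Omega> \<mu>"
      by linarith
  qed
qed

section \<open>The operator and its pseudoinverse\<close>

lemma dist_of_radon_add: "dist_of_radon \<Omega> (\<mu> + \<nu>) = dist_of_radon \<Omega> \<mu> + dist_of_radon \<Omega> \<nu>"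
  by (auto simp: dist_of_radon_def fun_eq_iff)

lemma dist_of_radon_scaleR: "dist_of_radon \<Omega> (c *\<^sub>R \<mu>) = c *\<^sub>R dist_of_radon \<Omega> \<mu>"
  by (auto simp: dist_of_radon_def scaleR_fun_def fun_eq_iff)

lemma dist_of_radon_0: "dist_of_radon \<Omega> 0 = 0"
  by (auto simp: dist_of_radon_def fun_eq_iff)

lemma op_BM_in_radon:
  assumes "open \<Omega>" "u \<in> pre_B \<Omega> L"
  shows "op_BM \<Omega> L u \<in> radon \<Omega>"
  unfolding op_BM_def
  by (rule the_inv_into_into[OF inj_on_dist_of_radon[OF assms(1)]])
     (use assms(2) in \<open>auto simp: pre_B_def\<close>)

lemma dist_of_radon_op_BM:
  assumes "open \<Omega>" "u \<in> pre_B \<Omega> L"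
  shows "dist_of_radon \<Omega> (op_BM \<Omega> L u) = L u"
  unfolding op_BM_def
  by (rule f_the_inv_into_f[OF inj_on_dist_of_radon[OF assms(1)]])
     (use assms(2) in \<open>auto simp: pre_B_def\<close>)

lemma op_BM_eqI:
  assumes "open \<Omega>" "\<mu> \<in> radon \<Omega>" "L u = dist_of_radon \<Omega> \<mu>"
  shows "op_BM \<Omega> L u = \<mu>"
  unfolding op_BM_def assms(3) by (rule the_inv_into_f_f[OF inj_on_dist_of_radon[OF assms(1)] assms(2)])

lemma linear_on_op_BM:
  assumes "open \<Omega>" "dist_operator \<Omega> L"
  shows "linear_on (space_B \<Omega> L k) (op_BM \<Omega> L)"
proof -
  have lin: "linear_on (distributions \<Omega>) L"
    using assms(2) by (simp add: dist_operator_def)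
  have pre: "u \<in> pre_B \<Omega> L" "u \<in> distributions \<Omega>" if "u \<in> space_B \<Omega> L k" for u
    using that by (auto simp: space_B_def pre_B_def)
  show ?thesis
    unfolding linear_on_def
  proof (intro conjI ballI allI)
    fix u w assume u: "u \<in> space_B \<Omega> L k" and w: "w \<in> space_B \<Omega> L k"
    have "L (u + w) = L u + L w"
      using lin pre(2)[OF u] pre(2)[OF w] by (simp add: linear_on_def)
    then show "op_BM \<Omega> L (u + w) = op_BM \<Omega> L u + op_BM \<Omega> L w"
      by (intro op_BM_eqI assms(1) subspace_add[OF subspace_radon] op_BM_in_radon pre u w)
         (simp add: dist_of_radon_add dist_of_radon_op_BM[OF assms(1)] pre u w)
  next
    fix u and c :: real assume u: "u \<in> space_B \<Omega> L k"
    have "L (c *\<^sub>R u) = c *\<^sub>R L u"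
      using lin pre(2)[OF u] by (simp add: linear_on_def)
    then show "op_BM \<Omega> L (c *\<^sub>R u) = c *\<^sub>R op_BM \<Omega> L u"
      by (intro op_BM_eqI assms(1) subspace_scale[OF subspace_radon] op_BM_in_radon pre u)
         (simp add: dist_of_radon_scaleR dist_of_radon_op_BM[OF assms(1)] pre u)
  qed
qed

lemma op_BM_eq_0_iff:
  assumes "open \<Omega>" "u \<in> space_B \<Omega> L k"
  shows "op_BM \<Omega> L u = 0 \<longleftrightarrow> u \<in> dist_kernel \<Omega> L"
proof -
  have u: "u \<in> pre_B \<Omega> L" "u \<in> distributions \<Omega>"
    using assms(2) by (auto simp: space_B_def pre_B_def)
  show ?thesis
    using dist_of_radon_op_BM[OF assms(1) u(1)] u(2)
      op_BM_eqI[OF assms(1) subspace_0[OF subspace_radon], of L u]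
    by (auto simp: dist_kernel_def dist_of_radon_0)
qed

text \<open>
  When \<open>X\<close> is the whole space, its complement \<open>W\<close> is trivial.
\<close>

lemma proj_along_whole_space:
  assumes "subspace W" "subspace X" "direct_sum X W X" "x \<in> X"
  shows "proj_along X W x = x"
proof -
  have "W \<subseteq> X"
    using assms(3) subspace_0[OF assms(2)] unfolding direct_sum_def by force
  then have "W = {0}"
    using assms(3) by (auto simp: direct_sum_def)
  then show ?thesis
    using assms(4) by (auto simp: proj_along_def intro!: the_equality)
qed

text \<open>
  Each \<open>\<mu>\<close> has a preimage, and the \<open>V\<close>-component of the preimage has the same image; it is the
  only one in \<open>V\<close>, since \<open>V\<close> meets the kernel trivially.
\<close>

lemma pinv_L_right_inverse:
  assumes "open \<Omega>" "dist_operator \<Omega> L" "subspace V" "subspace (space_B \<Omega> L k)"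
    and "direct_sum (dist_kernel \<Omega> L) V (space_B \<Omega> L k)"
    and "subspace W" "direct_sum (ran_L \<Omega> L k) W (radon \<Omega>)" "ran_L \<Omega> L k = radon \<Omega>"
    and "\<mu> \<in> radon \<Omega>"
  shows "pinv_L \<Omega> L k V W \<mu> \<in> space_B \<Omega> L k" "op_BM \<Omega> L (pinv_L \<Omega> L k V W \<mu>) = \<mu>"
proof -
  let ?B = "space_B \<Omega> L k" and ?T = "op_BM \<Omega> L"
  have lin: "linear_on ?B ?T"
    by (rule linear_on_op_BM[OF assms(1,2)])
  have "\<mu> \<in> ?T ` ?B"
    using assms(8,9) by (simp add: ran_L_def)
  then obtain u where u: "u \<in> ?B" "?T u = \<mu>"
    by blast
  have sum: "x \<in> ?B \<longleftrightarrow> (\<exists>s\<in>dist_kernel \<Omega> L. \<exists>t\<in>V. x = s + t)" for x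
  proof -
    have "?B = {s + t |s t. s \<in> dist_kernel \<Omega> L \<and> t \<in> V}"
      using assms(5) by (simp only: direct_sum_def)
    then show ?thesis by blast
  qed
  obtain s w where sw: "u = s + w" "s \<in> dist_kernel \<Omega> L" "w \<in> V"
    using u(1) unfolding sum by blast
  have inter: "dist_kernel \<Omega> L \<inter> V = {0}"
    using assms(5) by (simp only: direct_sum_def)
  then have "0 \<in> dist_kernel \<Omega> L"
    by blast
  then have VB: "x \<in> ?B" if "x \<in> V" for x
    unfolding sum using that by (intro bexI[of _ 0] bexI[of _ x]) simp_all
  have sB: "s \<in> ?B"
    using sw(1) u(1) VB[OF sw(3)] subspace_diff[OF assms(4), of u w] by simp
  have inj: "inj_on ?T V"
  proof (rule inj_onI)
    fix x y assume xy: "x \<in> V" "y \<in> V" "?T x = ?T y"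
    have V: "x - y \<in> V"
      by (rule subspace_diff[OF assms(3) xy(1,2)])
    moreover have "?T (x - y) = 0"
      using linear_on_diff[OF lin assms(4) VB[OF xy(1)] VB[OF xy(2)]] xy(3) by simp
    ultimately have "x - y \<in> dist_kernel \<Omega> L \<inter> V"
      using op_BM_eq_0_iff[OF assms(1) VB[OF V]] by blast
    then have "x - y = 0"
      unfolding inter by simp
    then show "x = y" by simp
  qed
  have "?T u = ?T s + ?T w"
    using lin sB VB[OF sw(3)] unfolding sw(1) linear_on_def by blast
  then have "?T w = \<mu>"
    using u(2) sw(2) op_BM_eq_0_iff[OF assms(1) sB] by simp
  moreover have "proj_along (ran_L \<Omega> L k) W \<mu> = \<mu>"
    unfolding assms(8)
    by (rule proj_along_whole_space[OF assms(6) subspace_radon assms(7)[unfolded assms(8)] assms(9)])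
  ultimately have "pinv_L \<Omega> L k V W \<mu> = w"
    unfolding pinv_L_def using the_inv_into_f_f[OF inj sw(3)] by simp
  with \<open>?T w = \<mu>\<close> VB[OF sw(3)] show "pinv_L \<Omega> L k V W \<mu> \<in> ?B" "?T (pinv_L \<Omega> L k V W \<mu>) = \<mu>"
    by auto
qed

section \<open>A minimizer supported on the vertices\<close>

theorem proposition7:
  fixes \<Omega> :: "(real^'d) set"
    and L :: "((real^'d \<Rightarrow> real) \<Rightarrow> real) \<Rightarrow> (real^'d \<Rightarrow> real) \<Rightarrow> real"
    and k :: "((real^'d \<Rightarrow> real) \<Rightarrow> real) \<Rightarrow> ennreal"
    and V W :: "((real^'d \<Rightarrow> real) \<Rightarrow> real) set"
    and a :: "'m::finite \<Rightarrow> ((real^'d \<Rightarrow> real) \<Rightarrow> real) \<Rightarrow> real"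
    and \<rho> :: "'m \<Rightarrow> real^'d \<Rightarrow> real"
    and f :: "real^'m \<Rightarrow> ereal"
    and \<P> :: "(real^'d) set set"
  assumes "open \<Omega>"
    and "dist_operator \<Omega> L"
    and "ext_seminorm_on (pre_B \<Omega> L) k"
    and "\<forall>u\<in>dist_kernel \<Omega> L. k u < \<infinity>"
    and "norm_on (dist_kernel \<Omega> L) (\<lambda>u. enn2real (k u))"
    and "banach_on (space_B \<Omega> L k) (norm_B \<Omega> L k)"
    and "closed_subspace_of V (space_B \<Omega> L k) (norm_B \<Omega> L k)"
    and "direct_sum (dist_kernel \<Omega> L) V (space_B \<Omega> L k)"
    and "closed_subspace_of (ran_L \<Omega> L k) (radon \<Omega>) (tv_norm \<Omega>)"
    and "closed_subspace_of W (radon \<Omega>) (tv_norm \<Omega>)"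
    and "direct_sum (ran_L \<Omega> L k) W (radon \<Omega>)"
    and "\<forall>i. a i \<in> dual_space (space_B \<Omega> L k) (norm_B \<Omega> L k)"
    and "\<forall>i. \<rho> i \<in> C0 \<Omega> \<and>
      adjoint_on (radon \<Omega>) (pinv_L \<Omega> L k V W) (a i) = C0_embed \<Omega> (\<rho> i)"
    and "\<exists>u. is_arg_min (primal_objective \<Omega> L f a) (\<lambda>u. u \<in> space_B \<Omega> L k) u"
    and "\<forall>y. f y \<noteq> -\<infinity>"
    and "ext_convex f"
    and "lower_semicont f"
    and "bounded \<Omega>"
    and "polyhedral_pieces \<Omega> \<P>"
    and "\<forall>i. \<forall>P\<in>\<P>. affine_on P (\<rho> i)"
    and "ran_L \<Omega> L k = radon \<Omega>"
    and "\<exists>q. is_arg_max (\<lambda>q. - fenchel_conj f q) (dual_feasible \<Omega> L k V W a) q"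
  shows "\<exists>uK\<in>dist_kernel \<Omega> L. \<exists>d :: real^'d \<Rightarrow> real.
    is_arg_min (primal_objective \<Omega> L f a) (\<lambda>u. u \<in> space_B \<Omega> L k)
      (uK + (\<Sum>v\<in>vertices \<P>. d v *\<^sub>R pinv_L \<Omega> L k V W (delta \<Omega> v)))"
proof -
  note op = \<open>open \<Omega>\<close> and dop = \<open>dist_operator \<Omega> L\<close> and full = \<open>ran_L \<Omega> L k = radon \<Omega>\<close>
  let ?B = "space_B \<Omega> L k" and ?T = "op_BM \<Omega> L" and ?S = "pinv_L \<Omega> L k V W"
    and ?J = "primal_objective \<Omega> L f a"
  have B: "subspace ?B"
    using assms(6) by (simp add: banach_on_def)
  have VW: "subspace V" "subspace W"
    using assms(7,10) by (simp_all add: closed_subspace_of_def)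
  have S: "?S \<mu> \<in> ?B" "?T (?S \<mu>) = \<mu>" if "\<mu> \<in> radon \<Omega>" for \<mu>
    using pinv_L_right_inverse[OF op dop VW(1) B assms(8) VW(2) assms(11) full that] by auto
  have T: "linear_on ?B ?T"
    by (rule linear_on_op_BM[OF op dop])
  have a: "linear_on ?B (a i)" for i
    using assms(12) by (simp add: dual_space_def)
  have \<rho>: "\<rho> i \<in> C0 \<Omega>" for i
    using assms(13) by blast
  have aS: "a i (?S \<mu>) = \<mu> (\<rho> i)" if "\<mu> \<in> radon \<Omega>" for i \<mu>
  proof -
    have "adjoint_on (radon \<Omega>) ?S (a i) \<mu> = C0_embed \<Omega> (\<rho> i) \<mu>"
      using assms(13) by simp
    with that show ?thesis
      by (simp add: adjoint_on_def C0_embed_def)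
  qed
  obtain u where u: "is_arg_min ?J (\<lambda>u. u \<in> ?B) u"
    using assms(14) by blast
  then have uB: "u \<in> ?B"
    by (simp add: is_arg_min_def)
  define \<nu> where "\<nu> = ?T u"
  have \<nu>: "\<nu> \<in> radon \<Omega>"
    using full uB by (auto simp: \<nu>_def ran_L_def)
  obtain d where d: "\<And>i. (\<Sum>v\<in>vertices \<P>. d v *\<^sub>R delta \<Omega> v) (\<rho> i) = \<nu> (\<rho> i)"
    "tv_norm \<Omega> (\<Sum>v\<in>vertices \<P>. d v *\<^sub>R delta \<Omega> v) \<le> tv_norm \<Omega> \<nu>"
    by (rule radon_discretization[OF \<nu> \<rho> assms(19)]) (use assms(20) in blast, rule that)
  define uK where "uK = u - ?S \<nu>"
  define w where "w = (\<Sum>v\<in>vertices \<P>. d v *\<^sub>R ?S (delta \<Omega> v))"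
  have fin: "finite (vertices \<P>)"
    by (rule finite_vertices[OF assms(19)])
  have uKB: "uK \<in> ?B"
    unfolding uK_def by (intro subspace_diff B uB S \<nu>)
  have wB: "w \<in> ?B"
    unfolding w_def by (intro subspace_sum subspace_scale B S delta_radon)
  have TuK: "?T uK = 0"
    using linear_on_diff[OF T B uB S(1)[OF \<nu>]] S(2)[OF \<nu>] by (simp add: uK_def \<nu>_def)
  have T_add: "?T (uK + w) = ?T uK + ?T w"
    using T uKB wB unfolding linear_on_def by blast
  have T_w: "?T w = (\<Sum>v\<in>vertices \<P>. d v *\<^sub>R delta \<Omega> v)"
    unfolding w_def by (simp add: linear_on_sum[OF T B fin] S delta_radon)
  have T_new: "?T (uK + w) = (\<Sum>v\<in>vertices \<P>. d v *\<^sub>R delta \<Omega> v)"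
    unfolding T_add TuK T_w by (rule add_0_left)
  have "a i (uK + w) = a i u" for i
  proof -
    have a_add: "a i (uK + w) = a i uK + a i w"
      using a[of i] uKB wB unfolding linear_on_def by blast
    have a_uK: "a i uK = a i u - \<nu> (\<rho> i)"
      unfolding uK_def by (simp add: linear_on_diff[OF a B uB S(1)[OF \<nu>]] aS[OF \<nu>])
    have "a i w = (\<Sum>v\<in>vertices \<P>. d v *\<^sub>R a i (?S (delta \<Omega> v)))"
      unfolding w_def by (rule linear_on_sum[OF a B fin S(1)[OF delta_radon]])
    also have "\<dots> = (\<Sum>v\<in>vertices \<P>. d v *\<^sub>R delta \<Omega> v) (\<rho> i)"
      by (simp add: aS[OF delta_radon] sum_fun_apply scaleR_fun_def)
    finally have a_w: "a i w = \<nu> (\<rho> i)"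
      by (simp only: d(1))
    show ?thesis
      unfolding a_add a_uK a_w by simp
  qed
  then have "measure_op a (uK + w) = measure_op a u"
    by (simp add: measure_op_def)
  then have "?J (uK + w) \<le> ?J u"
    using d(2) by (simp add: primal_objective_def T_new \<nu>_def add_left_mono)
  then have "is_arg_min ?J (\<lambda>u. u \<in> ?B) (uK + w)"
    using u subspace_add[OF B uKB wB] by (auto simp: is_arg_min_def not_less intro: order_trans)
  moreover have "uK \<in> dist_kernel \<Omega> L"
    using op_BM_eq_0_iff[OF op uKB] TuK by simp
  ultimately show ?thesis
    unfolding w_def by blast
qed

end
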